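(* There are absolute constants $C>0$ and $n_0$ such that for all integers $n\ge n_0$, $$\chi_3(n,n)\ \ge\ \log\log n-C\log\log\log n .$$
   Context: $[n]=\{1,\dots,n\}$; $\log$ is base 2. A line in $[n]^3$ is a set obtained by fixing two of the three coordinates and letting the remaining one vary over $[n]$. A 2-dimensional permutation of order $n$ is a function $f:[n]^3\to\{0,1\}$ such that every line contains exactly one point where $f=1$. A cylinder in dimension $i$ is a subset of $[n]^3$ closed under arbitrary changes of the $i$-th coordinate, and a cylinder intersection is a set $T_1\cap T_2\cap T_3$ with $T_i$ a cylinder in dimension $i$. $\chi_3(f)$ is the least number of cylinder intersections, each contained in $f^{-1}(1)$, whose union is $f^{-1}(1)$. $\chi_3(n,n)=\min_f\chi_3(f)$ over all 2-dimensional permutations $f:[n]^3\to\{0,1\}$. *)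

theory Defs
  imports Complex_Main
begin

type_synonym point = "nat \<times> nat \<times> nat"

definition cube :: "nat \<Rightarrow> point set" where
  "cube n = {1..n} \<times> {1..n} \<times> {1..n}"

definition lines :: "nat \<Rightarrow> point set set" where
  "lines n =
     {{(t, b, c) | t. t \<in> {1..n}} | b c. b \<in> {1..n} \<and> c \<in> {1..n}} \<union>
     {{(a, t, c) | t. t \<in> {1..n}} | a c. a \<in> {1..n} \<and> c \<in> {1..n}} \<union>
     {{(a, b, t) | t. t \<in> {1..n}} | a b. a \<in> {1..n} \<and> b \<in> {1..n}}"

text \<open>A function on the cube is represented by a total function whose values outside
  the cube are irrelevant to everything below.\<close>

definition perm2 :: "nat \<Rightarrow> (point \<Rightarrow> nat) \<Rightarrow> bool" where
  "perm2 n f \<longleftrightarrow>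
     (\<forall>p\<in>cube n. f p \<in> {0, 1}) \<and> (\<forall>L\<in>lines n. \<exists>!p. p \<in> L \<and> f p = 1)"

definition ones :: "nat \<Rightarrow> (point \<Rightarrow> nat) \<Rightarrow> point set" where
  "ones n f = {p \<in> cube n. f p = 1}"

definition cylinder1 :: "nat \<Rightarrow> point set \<Rightarrow> bool" where
  "cylinder1 n T \<longleftrightarrow> T \<subseteq> cube n \<and> (\<forall>a b c. (a, b, c) \<in> T \<longrightarrow> (\<forall>t\<in>{1..n}. (t, b, c) \<in> T))"

definition cylinder2 :: "nat \<Rightarrow> point set \<Rightarrow> bool" where
  "cylinder2 n T \<longleftrightarrow> T \<subseteq> cube n \<and> (\<forall>a b c. (a, b, c) \<in> T \<longrightarrow> (\<forall>t\<in>{1..n}. (a, t, c) \<in> T))"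

definition cylinder3 :: "nat \<Rightarrow> point set \<Rightarrow> bool" where
  "cylinder3 n T \<longleftrightarrow> T \<subseteq> cube n \<and> (\<forall>a b c. (a, b, c) \<in> T \<longrightarrow> (\<forall>t\<in>{1..n}. (a, b, t) \<in> T))"

definition cylinder_intersection :: "nat \<Rightarrow> point set \<Rightarrow> bool" where
  "cylinder_intersection n S \<longleftrightarrow>
     (\<exists>T1 T2 T3. cylinder1 n T1 \<and> cylinder2 n T2 \<and> cylinder3 n T3 \<and> S = T1 \<inter> T2 \<inter> T3)"

definition cylinder_cover :: "nat \<Rightarrow> (point \<Rightarrow> nat) \<Rightarrow> point set set \<Rightarrow> bool" where
  "cylinder_cover n f \<S> \<longleftrightarrow>
     (\<forall>S\<in>\<S>. cylinder_intersection n S \<and> S \<subseteq> ones n f) \<and> \<Union>\<S> = ones n f"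

definition chi3 :: "nat \<Rightarrow> (point \<Rightarrow> nat) \<Rightarrow> nat" where
  "chi3 n f = (LEAST k. \<exists>\<S>. finite \<S> \<and> card \<S> = k \<and> cylinder_cover n f \<S>)"

definition chi3_min :: "nat \<Rightarrow> nat" where
  "chi3_min n = (LEAST k. \<exists>f. perm2 n f \<and> chi3 n f = k)"

text \<open>Both minima range over nonempty sets (the second one for positive order), so
  \<^const>\<open>Least\<close> never takes an unspecified value here.\<close>

lemma cylinder_intersection_singleton:
  assumes "p \<in> cube n"
  shows "cylinder_intersection n {p}"
proof -
  obtain a b c where p: "p = (a, b, c)" by (cases p)
  have "cylinder1 n ({1..n} \<times> {b} \<times> {c})" "cylinder2 n ({a} \<times> {1..n} \<times> {c})"
       "cylinder3 n ({a} \<times> {b} \<times> {1..n})"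
    using assms by (auto simp: p cube_def cylinder1_def cylinder2_def cylinder3_def)
  moreover have "{p} = ({1..n} \<times> {b} \<times> {c}) \<inter> ({a} \<times> {1..n} \<times> {c}) \<inter> ({a} \<times> {b} \<times> {1..n})"
    using assms by (auto simp: p cube_def)
  ultimately show ?thesis
    unfolding cylinder_intersection_def by blast
qed

lemma ex_cylinder_cover: "\<exists>\<S>. finite \<S> \<and> cylinder_cover n f \<S>"
proof (intro exI conjI)
  show "finite ((\<lambda>p. {p}) ` ones n f)"
    by (simp add: ones_def cube_def)
  show "cylinder_cover n f ((\<lambda>p. {p}) ` ones n f)"
    by (auto simp: cylinder_cover_def ones_def intro: cylinder_intersection_singleton)
qed

lemma ex1_residue:
  fixes m :: int
  assumes "n > 0"
  shows "\<exists>!t. t \<in> {1..n} \<and> int n dvd int t + m"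
proof -
  define t where "t = nat ((- m - 1) mod int n) + 1"
  have bnd: "0 \<le> (- m - 1) mod int n" "(- m - 1) mod int n < int n"
    using assms by auto
  have "int t + m = - ((- m - 1) - (- m - 1) mod int n)"
    using bnd by (simp add: t_def)
  then have "int n dvd int t + m"
    by (metis dvd_minus_iff dvd_minus_mod)
  moreover have "t \<in> {1..n}"
    using bnd by (auto simp: t_def)
  moreover have "s = t" if "s \<in> {1..n}" "int n dvd int s + m" for s
  proof -
    have "int n dvd int s - int t"
      using dvd_diff[OF that(2) \<open>int n dvd int t + m\<close>] by simp
    moreover have "\<bar>int s - int t\<bar> < int n"
      using that(1) \<open>t \<in> {1..n}\<close> by auto
    ultimately show ?thesis
      using zdvd_not_zless[of "\<bar>int s - int t\<bar>" "int n"] by force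
  qed
  ultimately show ?thesis by blast
qed

lemma ex_perm2:
  assumes "n > 0"
  shows "\<exists>f. perm2 n f"
proof
  define f :: "point \<Rightarrow> nat"
    where "f = (\<lambda>(a, b, c). if int n dvd int a + int b + int c then 1 else 0)"
  have *: "\<exists>!p. p \<in> {g t | t. t \<in> {1..n}} \<and> f p = 1"
    if "\<And>t. f (g t) = 1 \<longleftrightarrow> int n dvd int t + m" for g m
    using ex1_residue[OF assms, of m] that by (smt (verit, ccfv_threshold) mem_Collect_eq)
  have "\<exists>!p. p \<in> L \<and> f p = 1" if L: "L \<in> lines n" for L
  proof -
    consider b c where "L = {(t, b, c) | t. t \<in> {1..n}}"
      | a c where "L = {(a, t, c) | t. t \<in> {1..n}}"
      | a b where "L = {(a, b, t) | t. t \<in> {1..n}}"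
      using L unfolding lines_def by blast
    then show ?thesis
    proof cases
      case (1 b c)
      show ?thesis unfolding 1
        by (rule *[of _ "int b + int c"]) (simp add: f_def algebra_simps)
    next
      case (2 a c)
      show ?thesis unfolding 2
        by (rule *[of _ "int a + int c"]) (simp add: f_def algebra_simps)
    next
      case (3 a b)
      show ?thesis unfolding 3
        by (rule *[of _ "int a + int b"]) (simp add: f_def algebra_simps)
    qed
  qed
  then show "perm2 n f"
    by (auto simp: perm2_def f_def)
qed

end

theory Submission
  imports Defs
begin

text \<open>A 2-dimensional permutation is the graph of a Latin square \<open>L\<close>, and a cylinder intersection
  inside it is a set of cells without a corner \<open>(a, b)\<close>, \<open>(a, b')\<close>, \<open>(a', b)\<close> in which the last
  two cells carry the same symbol and the first a different one. The argument is the density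
  decrement of Graham and Solymosi: in an \<open>m \<times> m\<close> subgrid choose the most popular pair
  of a symbol and a covering set. The cells carrying it span a smaller grid in which that covering set can
  only be used by the chosen symbol. With \<open>k\<close> covering sets the side of the grid
  passes from \<open>m\<close> to at least \<open>m\<^sup>2 / (2 k n)\<close>, so after \<open>k\<close> steps
  \<open>n < (2 k) ^ 2 ^ k\<close>.\<close>

section \<open>Covers of Latin grids by corner-free sets\<close>

lemma card_UN_le_mult:
  assumes "finite I" "\<And>i. i \<in> I \<Longrightarrow> card (A i) \<le> q"
  shows "card (\<Union>i\<in>I. A i) \<le> card I * q"
  using card_UN_le[OF assms(1), of A] sum_bounded_above[of I "\<lambda>i. card (A i)" q] assms(2)
  by fastforce

text \<open>For \<open>S\<close> projected from a cylinder intersection, put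
  \<open>c = L a b'\<close>: the three cells lift to \<open>(a, b, L a b)\<close>,
  \<open>(a, b', c)\<close>, \<open>(a', b, c)\<close>, a star around \<open>(a, b, c)\<close>.
  Degenerate triples with \<open>a = a'\<close> or \<open>b = b'\<close> satisfy the implication
  trivially.\<close>

definition corner_free :: "('a \<Rightarrow> 'b \<Rightarrow> 'c) \<Rightarrow> ('a \<times> 'b) set \<Rightarrow> bool" where
  "corner_free L S \<longleftrightarrow>
     (\<forall>a b a' b'. (a, b) \<in> S \<longrightarrow> (a, b') \<in> S \<longrightarrow> (a', b) \<in> S \<longrightarrow> L a b' = L a' b \<longrightarrow> L a b = L a b')"

text \<open>Here \<open>R\<close> holds the covering sets still in use and \<open>D\<close> the
  symbols already chosen, whose cells \<open>R\<close> may miss. A symbol occurs at most once per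
  row, so \<open>D\<close> accounts for at most half of the grid. Pigeonhole over pairs of a symbol
  and a member of \<open>R\<close> handles the rest.\<close>

lemma popular_symbol:
  fixes L :: "'a \<Rightarrow> 'b \<Rightarrow> 'c"
  assumes fin: "finite X" "finite Y" "finite Z" "finite R" "finite D"
    and card: "card X = m" "card Y = m" "card D + card R \<le> k" "2 * k \<le> m"
    and L: "\<And>a b. a \<in> X \<Longrightarrow> b \<in> Y \<Longrightarrow> L a b \<in> Z"
    and inj: "\<And>a. a \<in> X \<Longrightarrow> inj_on (L a) Y"
    and cov: "\<And>a b. a \<in> X \<Longrightarrow> b \<in> Y \<Longrightarrow> L a b \<notin> D \<Longrightarrow> (a, b) \<in> \<Union>R"
    and "m > 0"
  obtains c S where "S \<in> R"
    "m\<^sup>2 \<le> 2 * k * card Z * card {(a, b). a \<in> X \<and> b \<in> Y \<and> (a, b) \<in> S \<and> L a b = c}"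
proof -
  define A where "A = (\<lambda>(c, S). {(a, b). a \<in> X \<and> b \<in> Y \<and> (a, b) \<in> S \<and> L a b = c})"
  define B where "B = (\<lambda>(a, d). {(a', b). a' = a \<and> b \<in> Y \<and> L a b = d})"
  \<comment> \<open>The inserted 0 keeps \<open>Max\<close> meaningful while \<open>R\<close> could
    still be empty.\<close>
  define M where "M = Max (insert 0 (card ` A ` (Z \<times> R)))"
  have finZR: "finite (Z \<times> R)" using fin by simp
  have "card (B i) \<le> 1" if iX: "i \<in> X \<times> D" for i
  proof -
    obtain a d where i: "i = (a, d)" by (cases i)
    have "x = y" if "x \<in> B i" "y \<in> B i" for x y
      using that iX inj[of a] by (auto simp: B_def i inj_on_def)
    then show ?thesis
      by (metis One_nat_def card_le_Suc0_iff_eq card.infinite le_zero_eq nat_le_linear)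
  qed
  then have "card (\<Union>i\<in>X \<times> D. B i) \<le> card (X \<times> D) * 1"
    by (intro card_UN_le_mult) (use fin in auto)
  also have "\<dots> \<le> m * (k - card R)"
    using card by (auto simp: card_cartesian_product)
  finally have B: "card (\<Union>i\<in>X \<times> D. B i) \<le> m * (k - card R)" .
  have AM: "card (A i) \<le> M" if "i \<in> Z \<times> R" for i
    unfolding M_def using finZR that by (intro Max_ge) auto
  have A: "card (\<Union>i\<in>Z \<times> R. A i) \<le> card Z * card R * M"
    using card_UN_le_mult[OF finZR AM] by (simp add: card_cartesian_product)
  have sub: "(\<Union>i\<in>Z \<times> R. A i) \<union> (\<Union>i\<in>X \<times> D. B i) \<subseteq> X \<times> Y"
    by (auto simp: A_def B_def)
  have "X \<times> Y \<subseteq> (\<Union>i\<in>Z \<times> R. A i) \<union> (\<Union>i\<in>X \<times> D. B i)"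
  proof
    fix p assume "p \<in> X \<times> Y"
    then obtain a b where p: "p = (a, b)" "a \<in> X" "b \<in> Y" by auto
    show "p \<in> (\<Union>i\<in>Z \<times> R. A i) \<union> (\<Union>i\<in>X \<times> D. B i)"
    proof (cases "L a b \<in> D")
      case True
      then have "p \<in> B (a, L a b)" "(a, L a b) \<in> X \<times> D" using p by (auto simp: B_def)
      then show ?thesis by blast
    next
      case False
      then obtain S where "S \<in> R" "(a, b) \<in> S" using cov p by blast
      then have "p \<in> A (L a b, S)" "(L a b, S) \<in> Z \<times> R" using p L by (auto simp: A_def)
      then show ?thesis by blast
    qed
  qed
  then have "card (X \<times> Y) \<le> card ((\<Union>i\<in>Z \<times> R. A i) \<union> (\<Union>i\<in>X \<times> D. B i))"
    using fin finite_subset[OF sub] by (intro card_mono) auto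
  also have "\<dots> \<le> card Z * card R * M + m * (k - card R)"
    using A B card_Un_le by (meson add_mono le_trans)
  finally have 1: "m * m \<le> card Z * card R * M + m * (k - card R)"
    by (simp add: card card_cartesian_product)
  \<comment> \<open>The cells with a symbol in \<open>D\<close> fill at most half of the grid
    because \<open>2 * k \<le> m\<close>; this is where the factor 2 comes from.\<close>
  have "m * (k - card R) + m * (k - card R) \<le> m * m"
    unfolding add_mult_distrib2[symmetric] using card by (intro mult_le_mono2) linarith
  moreover have "card Z * card R * M \<le> card Z * k * M"
    using card by simp
  ultimately have 2: "m\<^sup>2 \<le> 2 * k * card Z * M"
    using 1 unfolding power2_eq_square by (simp only: mult.assoc mult.left_commute[of k])
  have "M \<in> insert 0 (card ` A ` (Z \<times> R))"
    unfolding M_def using finZR by (intro Max_in) auto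
  \<comment> \<open>So the maximum is attained by a genuine class, which also shows that
    \<open>R\<close> is nonempty.\<close>
  moreover have "M \<noteq> 0" using 2 \<open>m > 0\<close> by (intro notI) simp
  ultimately obtain c S where "S \<in> R" "M = card (A (c, S))" by blast
  then show thesis using 2 that[of S c] by (simp add: A_def)
qed

text \<open>With \<open>n = card Z\<close> and \<open>q = m / (2kn)\<close>, the claim reads
  \<open>q ^ 2 ^ card R < 1 / n\<close>. A decrement step yields a grid whose ratio is at least
  \<open>q\<^sup>2\<close> while \<open>card R\<close> drops by one, so the claim passes back from
  the smaller grid. It holds outright once \<open>m < 2 * k\<close>. Each step moves one unit from
  \<open>R\<close> to at most one in \<open>D\<close>, so \<open>k\<close> stays fixed.\<close>

lemma corner_free_cover_bound:
  fixes L :: "'a \<Rightarrow> 'b \<Rightarrow> 'c"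
  assumes "finite X" "finite Y" "finite Z" "finite R" "finite D"
    and "card X = m" "card Y = m" "card D + card R \<le> k" "card Z > 0" "k > 0"
    and "\<And>a b. a \<in> X \<Longrightarrow> b \<in> Y \<Longrightarrow> L a b \<in> Z"
    and "\<And>a. a \<in> X \<Longrightarrow> inj_on (L a) Y"
    and "\<And>b. b \<in> Y \<Longrightarrow> inj_on (\<lambda>a. L a b) X"
    and "\<And>S. S \<in> R \<Longrightarrow> corner_free L S"
    and "\<And>a b. a \<in> X \<Longrightarrow> b \<in> Y \<Longrightarrow> L a b \<notin> D \<Longrightarrow> (a, b) \<in> \<Union>R"
  shows "m ^ 2 ^ card R * card Z < (2 * k * card Z) ^ 2 ^ card R"
  using assms
proof (induction "card R" arbitrary: R X Y D m rule: less_induct)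
  case less
  note prems = less.prems
  let ?n = "card Z"
  show ?case
  proof (cases "m < 2 * k")
    case True
    have "m ^ 2 ^ card R * ?n < (2 * k) ^ 2 ^ card R * ?n"
      using True prems(9) by (intro mult_strict_right_mono power_strict_mono) auto
    also have "\<dots> \<le> (2 * k) ^ 2 ^ card R * ?n ^ 2 ^ card R"
      using prems(9) by (simp add: self_le_power)
    finally show ?thesis by (simp only: power_mult_distrib)
  next
    case False
    then have m: "2 * k \<le> m" "m > 0" using prems(10) by auto
    obtain c S where S: "S \<in> R" and pop:
      "m\<^sup>2 \<le> 2 * k * ?n * card {(a, b). a \<in> X \<and> b \<in> Y \<and> (a, b) \<in> S \<and> L a b = c}"
      using popular_symbol[of X Y Z R D m k L, OF prems(1-8) m(1) prems(11,12,15) m(2)] by blast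
    define A where "A = {(a, b). a \<in> X \<and> b \<in> Y \<and> (a, b) \<in> S \<and> L a b = c}"
    \<comment> \<open>All cells of \<open>A\<close> carry the symbol \<open>c\<close>, so no two
      share a row or a column: \<open>A\<close> spans a square grid of side
      \<open>card A\<close>.\<close>
    have fst: "inj_on fst A"
      by (rule inj_onI) (use prems(12) in \<open>auto simp: A_def inj_on_def\<close>)
    have snd: "inj_on snd A"
      by (rule inj_onI) (use prems(13) in \<open>auto simp: A_def inj_on_def\<close>)
    have sub: "fst ` A \<subseteq> X" "snd ` A \<subseteq> Y" by (auto simp: A_def)
    have R: "card R = Suc (card (R - {S}))"
      using S prems(4) by (simp only: card_Suc_Diff1)
    define N :: nat where "N = 2 ^ card (R - {S})"
    have IH: "card A ^ N * ?n < (2 * k * ?n) ^ N"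
      unfolding N_def
    proof (rule less.hyps[where X = "fst ` A" and Y = "snd ` A" and D = "insert c D"])
      show "card (R - {S}) < card R" using R by simp
      show "finite (fst ` A)" "finite (snd ` A)"
        using sub prems(1,2) finite_subset by blast+
      show "card (fst ` A) = card A" "card (snd ` A) = card A"
        using fst snd by (simp_all add: card_image)
      show "card (insert c D) + card (R - {S}) \<le> k"
        using R prems(8) card_insert_le_m1[of "Suc (card D)" D c] by simp
      show "L a b \<in> Z" if "a \<in> fst ` A" "b \<in> snd ` A" for a b
        using that sub prems(11) by blast
      show "inj_on (L a) (snd ` A)" if "a \<in> fst ` A" for a
        using that sub prems(12) by (meson inj_on_subset subsetD)
      show "inj_on (\<lambda>a. L a b) (fst ` A)" if "b \<in> snd ` A" for b
        using that sub prems(13) by (meson inj_on_subset subsetD)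
      show "(a, b) \<in> \<Union>(R - {S})" if ab: "a \<in> fst ` A" "b \<in> snd ` A" "L a b \<notin> insert c D" for a b
      proof -
        obtain b' a' where "(a, b') \<in> S" "L a b' = c" "(a', b) \<in> S" "L a' b = c"
          using ab(1,2) by (auto simp: A_def)
        then have "(a, b) \<notin> S"
          using prems(14)[OF S] ab(3) unfolding corner_free_def by (metis insertI1)
        moreover have "(a, b) \<in> \<Union>R" using prems(15) ab sub by blast
        ultimately show ?thesis by blast
      qed
    qed (use prems sub in auto)
    have "m ^ 2 ^ card R * ?n = (m\<^sup>2) ^ N * ?n"
      by (simp add: R N_def power_mult)
    also have "\<dots> \<le> (2 * k * ?n * card A) ^ N * ?n"
      using pop by (simp add: A_def power_mono)
    also have "\<dots> = (2 * k * ?n) ^ N * (card A ^ N * ?n)"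
      by (simp only: power_mult_distrib mult.assoc)
    also have "\<dots> < (2 * k * ?n) ^ N * (2 * k * ?n) ^ N"
      using IH prems(9,10) by (intro mult_strict_left_mono) auto
    also have "\<dots> = (2 * k * ?n) ^ 2 ^ card R"
      by (simp add: R N_def flip: power_add mult_2)
    finally show ?thesis .
  qed
qed

section \<open>From permutations and cylinder intersections to Latin squares\<close>

lemma perm2_lines:
  assumes "perm2 n f" "x \<in> {1..n}" "y \<in> {1..n}"
  shows "\<exists>!t. t \<in> {1..n} \<and> f (t, x, y) = 1"
    and "\<exists>!t. t \<in> {1..n} \<and> f (x, t, y) = 1"
    and "\<exists>!t. t \<in> {1..n} \<and> f (x, y, t) = 1"
proof -
  have *: "\<exists>!t. t \<in> {1..n} \<and> f (g t) = 1" if "{g t | t. t \<in> {1..n}} \<in> lines n" "inj g" for g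
  proof -
    have "\<exists>!p. p \<in> {g t | t. t \<in> {1..n}} \<and> f p = 1"
      by (rule bspec[OF conjunct2[OF assms(1)[unfolded perm2_def]] that(1)])
    then obtain t where "t \<in> {1..n}" "f (g t) = 1"
      and unique: "\<And>s. s \<in> {1..n} \<Longrightarrow> f (g s) = 1 \<Longrightarrow> g s = g t"
      by blast
    then show ?thesis using injD[OF that(2)] by blast
  qed
  have "{(t, x, y) | t. t \<in> {1..n}} \<in> lines n"
    unfolding lines_def by (intro UnI1 CollectI exI[of _ x] exI[of _ y] conjI refl assms(2,3))
  then show "\<exists>!t. t \<in> {1..n} \<and> f (t, x, y) = 1"
    by (rule *) (simp add: inj_def)
  have "{(x, t, y) | t. t \<in> {1..n}} \<in> lines n"
    unfolding lines_def by (rule UnI1, rule UnI2) (intro CollectI exI[of _ x] exI[of _ y] conjI refl assms(2,3))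
  then show "\<exists>!t. t \<in> {1..n} \<and> f (x, t, y) = 1"
    by (rule *) (simp add: inj_def)
  have "{(x, y, t) | t. t \<in> {1..n}} \<in> lines n"
    unfolding lines_def by (intro UnI2 CollectI exI[of _ x] exI[of _ y] conjI refl assms(2,3))
  then show "\<exists>!t. t \<in> {1..n} \<and> f (x, y, t) = 1"
    by (rule *) (simp add: inj_def)
qed

text \<open>Each of the three points differs from the centre in one coordinate only, and the
  cylinder in that dimension ignores this coordinate.\<close>

lemma cylinder_intersection_star:
  assumes "cylinder_intersection n S" "(a', b, c) \<in> S" "(a, b', c) \<in> S" "(a, b, c') \<in> S"
  shows "(a, b, c) \<in> S"
proof -
  obtain T1 T2 T3 where T: "cylinder1 n T1" "cylinder2 n T2" "cylinder3 n T3" "S = T1 \<inter> T2 \<inter> T3"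
    using assms(1) unfolding cylinder_intersection_def by blast
  have "a \<in> {1..n}" "b \<in> {1..n}" "c \<in> {1..n}"
    using T assms(2,3) unfolding cylinder1_def cube_def by auto
  then show ?thesis
    using T assms(2-4) unfolding cylinder1_def cylinder2_def cylinder3_def by blast
qed

lemma cylinder_cover_bound:
  assumes f: "perm2 n f" and cov: "cylinder_cover n f \<S>" and fin: "finite \<S>" and "n > 0"
  shows "card \<S> > 0" "n < (2 * card \<S>) ^ 2 ^ card \<S>"
proof -
  \<comment> \<open>The Latin square with graph \<open>ones n f\<close>: lines in the third
    direction make it well defined on the grid, and the other two directions give injectivity in
    rows and columns.\<close>
  define L where "L = (\<lambda>a b. THE c. c \<in> {1..n} \<and> f (a, b, c) = 1)"
  have L: "L a b \<in> {1..n} \<and> f (a, b, L a b) = 1" if "a \<in> {1..n}" "b \<in> {1..n}" for a b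
    unfolding L_def by (rule theI'[OF perm2_lines(3)[OF f that]])
  have L_eq: "c = L a b" if "(a, b, c) \<in> ones n f" for a b c
    using that perm2_lines(3)[OF f, of a b] L[of a b] unfolding ones_def cube_def by auto
  have in_ones: "(a, b, L a b) \<in> ones n f" if "a \<in> {1..n}" "b \<in> {1..n}" for a b
    using L[OF that] that unfolding ones_def cube_def by auto
  define cells :: "point set \<Rightarrow> (nat \<times> nat) set"
    where "cells = (\<lambda>S. {(a, b). (a, b, L a b) \<in> S})"
  have "(1, 1, L 1 1) \<in> \<Union>\<S>"
    using in_ones[of 1 1] \<open>n > 0\<close> cov unfolding cylinder_cover_def by auto
  then show k: "card \<S> > 0" using fin card_gt_0_iff by blast
  have cf: "corner_free L (cells S)" if "S \<in> \<S>" for S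
    unfolding corner_free_def
  proof (intro allI impI)
    fix a b a' b'
    assume *: "(a, b) \<in> cells S" "(a, b') \<in> cells S" "(a', b) \<in> cells S" "L a b' = L a' b"
    have S: "cylinder_intersection n S" "S \<subseteq> ones n f"
      using cov that unfolding cylinder_cover_def by auto
    \<comment> \<open>The centre of the star lies in \<open>ones n f\<close>, so its third
      coordinate must be the symbol \<open>L a b\<close>.\<close>
    have "(a, b, L a b') \<in> S"
      by (rule cylinder_intersection_star[OF S(1), of a' b _ a b' "L a b"])
        (use * in \<open>auto simp: cells_def\<close>)
    then show "L a b = L a b'" using S(2) L_eq by auto
  qed
  have cells: "card (cells ` \<S>) \<le> card \<S>" by (rule card_image_le[OF fin])
  let ?N = "2 ^ card (cells ` \<S>) :: nat"
  have "n ^ ?N * card {1..n} < (2 * card \<S> * card {1..n}) ^ ?N"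
  proof (rule corner_free_cover_bound[where X = "{1..n}" and Y = "{1..n}" and D = "{}" and L = L])
    show "inj_on (L a) {1..n}" if a: "a \<in> {1..n}" for a
    proof (rule inj_onI)
      fix x y assume "x \<in> {1..n}" "y \<in> {1..n}" "L a x = L a y"
      then show "x = y" using perm2_lines(2)[OF f a, of "L a x"] L[OF a, of x] L[OF a, of y] by auto
    qed
    show "inj_on (\<lambda>a. L a b) {1..n}" if b: "b \<in> {1..n}" for b
    proof (rule inj_onI)
      fix x y assume "x \<in> {1..n}" "y \<in> {1..n}" "L x b = L y b"
      then show "x = y" using perm2_lines(1)[OF f b, of "L x b"] L[of x, OF _ b] L[of y, OF _ b] by auto
    qed
    show "(a, b) \<in> \<Union>(cells ` \<S>)" if "a \<in> {1..n}" "b \<in> {1..n}" for a b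
      using in_ones[OF that] cov unfolding cylinder_cover_def cells_def by auto
  qed (use fin cells k cf L \<open>n > 0\<close> in auto)
  \<comment> \<open>Side and number of symbols are both \<open>n\<close>, so \<open>n ^ ?N\<close>
    cancels and a single factor \<open>n\<close> remains on the left.\<close>
  then have "n < (2 * card \<S>) ^ ?N"
    using \<open>n > 0\<close> by (simp add: power_mult_distrib mult.commute)
  also have "\<dots> \<le> (2 * card \<S>) ^ 2 ^ card \<S>"
    using k cells by (intro power_increasing) auto
  finally show "n < (2 * card \<S>) ^ 2 ^ card \<S>" .
qed

lemma chi3_min_bound:
  assumes "n > 0"
  shows "chi3_min n > 0" "n < (2 * chi3_min n) ^ 2 ^ chi3_min n"
proof -
  have "\<exists>f. perm2 n f \<and> chi3 n f = chi3_min n"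
    unfolding chi3_min_def by (rule LeastI_ex) (use ex_perm2[OF assms] in blast)
  then obtain f where f: "perm2 n f" "chi3 n f = chi3_min n" by blast
  have "\<exists>\<S>. finite \<S> \<and> card \<S> = chi3 n f \<and> cylinder_cover n f \<S>"
    unfolding chi3_def by (rule LeastI_ex) (use ex_cylinder_cover in blast)
  then obtain \<S> where "finite \<S>" "card \<S> = chi3_min n" "cylinder_cover n f \<S>"
    using f(2) by auto
  then show "chi3_min n > 0" "n < (2 * chi3_min n) ^ 2 ^ chi3_min n"
    using cylinder_cover_bound[OF f(1) _ _ assms, of \<S>] by simp_all
qed

section \<open>Solving the double exponential bound for \<open>k\<close>\<close>

lemma log2_one_plus_le:
  fixes z :: real
  assumes "z \<ge> 1"
  shows "log 2 (1 + z) \<le> z"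
proof -
  have "ln (1 + z) = ln 2 + ln ((1 + z) / 2)"
    using assms by (simp add: ln_div)
  also have "ln ((1 + z) / 2) \<le> (z - 1) * (1 / 2)"
    using ln_le_minus_one[of "(1 + z) / 2"] assms by (simp add: field_simps)
  \<comment> \<open>From \<open>exp (- ln 2) = 1 / 2\<close> and \<open>exp x \<ge> 1 + x\<close>
    one gets \<open>1 / 2 \<le> ln 2\<close>.\<close>
  also have "(z - 1) * (1 / 2) \<le> (z - 1) * ln 2"
    using exp_ge_add_one_self[of "- ln 2"] assms by (intro mult_left_mono) (auto simp: exp_minus)
  finally show ?thesis by (simp add: log_def divide_le_eq algebra_simps)
qed

text \<open>Two logarithms give \<open>y \<le> k + log 2 (1 + log 2 k)\<close>. If
  \<open>k < y\<close>, then \<open>log 2 k \<le> z\<close>, and the correction is at most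
  \<open>log 2 (1 + z) \<le> z\<close>; if \<open>k \<ge> y\<close>, the claim is immediate.\<close>

lemma log_log_le_of_less_power:
  fixes n k :: nat
  assumes "n < (2 * k) ^ 2 ^ k" "k > 0" "n \<ge> 16"
    and y: "2 \<le> log 2 (log 2 (real n))"
  shows "log 2 (log 2 (real n)) - log 2 (log 2 (log 2 (real n))) \<le> real k"
proof -
  define y where "y = log 2 (log 2 (real n))"
  define z where "z = log 2 y"
  have z: "z \<ge> 1" using y by (simp add: z_def y_def)
  show ?thesis
  proof (cases "y \<le> real k")
    case True
    then show ?thesis using z unfolding z_def y_def by linarith
  next
    case False
    have lk: "0 \<le> log 2 (real k)" using assms(2) by simp
    have "real n \<le> (2 * real k) ^ 2 ^ k"
      using assms(1) by (metis of_nat_less_iff of_nat_power of_nat_mult of_nat_numeral less_imp_le)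
    then have "log 2 (real n) \<le> log 2 ((2 * real k) ^ 2 ^ k)"
      using assms(2,3) by (subst log_le_cancel_iff) auto
    also have "\<dots> = 2 ^ k * (1 + log 2 (real k))"
      using assms(2) by (simp add: log_nat_power log_mult distrib_left)
    finally have 1: "log 2 (real n) \<le> 2 ^ k * (1 + log 2 (real k))" .
    have "log 2 (real n) > 0" using assms(3) by simp
    then have "y \<le> log 2 (2 ^ k * (1 + log 2 (real k)))"
      unfolding y_def using 1 lk by (subst log_le_cancel_iff) (auto intro!: add_pos_nonneg)
    also have "\<dots> = real k + log 2 (1 + log 2 (real k))"
      using lk by (subst log_mult) (auto simp: log_nat_power)
    also have "log 2 (1 + log 2 (real k)) \<le> log 2 (1 + z)"
    proof -
      have "log 2 (real k) \<le> z"
        unfolding z_def using False assms(2) by (subst log_le_cancel_iff) auto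
      then show ?thesis using lk by (subst log_le_cancel_iff) auto
    qed
    also have "log 2 (1 + z) \<le> z" by (rule log2_one_plus_le[OF z])
    finally show ?thesis unfolding z_def y_def by simp
  qed
qed

theorem theorem36:
  shows "\<exists>(C::real) (n0::nat). C > 0 \<and>
    (\<forall>n\<ge>n0. real (chi3_min n) \<ge>
       log 2 (log 2 (real n)) - C * log 2 (log 2 (log 2 (real n))))"
proof (intro exI conjI allI impI)
  \<comment> \<open>The witnesses are \<open>C = 1\<close> and \<open>n0 = 16\<close>; the double
    logarithm of 16 is 2, so the triple logarithm is at least 1 from there on.\<close>
  fix n :: nat assume n: "n \<ge> 16"
  have "log 2 (real n) \<ge> log 2 (2 ^ 4)" using n by (subst log_le_cancel_iff) auto
  then have "log 2 (real n) \<ge> 2 ^ 2" by (subst (asm) log_nat_power) auto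
  then have "log 2 (log 2 (real n)) \<ge> log 2 (2 ^ 2)" by (subst log_le_cancel_iff) auto
  then have "log 2 (log 2 (real n)) \<ge> 2" by (subst (asm) log_nat_power) auto
  then show "real (chi3_min n) \<ge>
       log 2 (log 2 (real n)) - 1 * log 2 (log 2 (log 2 (real n)))"
    using log_log_le_of_less_power[OF chi3_min_bound(2,1) n] n by simp
qed simp

end
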